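(* Let $n\ge 1$ and let $\pi\in S_n$. Define $\Psi_{\mathrm{PF}\to\mathrm{Sub}}:\mathcal{O}^{-1}_{\mathrm{MVP}_n}(\pi)\to \mathrm{Sub}(\pi)$ by $\Psi_{\mathrm{PF}\to\mathrm{Sub}}(p)=\{(j,i)\in\mathrm{Inv}(\pi):\ p_{\pi_i}=j\}$, and $\Psi_{\mathrm{Sub}\to\mathrm{PF}}:\mathrm{Sub}(\pi)\to\mathrm{MVP}_n$ by $\Psi_{\mathrm{Sub}\to\mathrm{PF}}(S)=p$ where, for each $i\in[n]$, $p_{\pi_i}=i$ if there is no $j$ with $(j,i)\in S$, and $p_{\pi_i}=j$ if $j$ is the unique index with $(j,i)\in S$. Then both maps are injective, and for every $p\in\mathcal{O}^{-1}_{\mathrm{MVP}_n}(\pi)$ we have $\Psi_{\mathrm{Sub}\to\mathrm{PF}}(\Psi_{\mathrm{PF}\to\mathrm{Sub}}(p))=p$.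
   Context: Let $[n]=\{1,\dots,n\}$. A parking preference is $p=(p_1,\dots,p_n)\in[n]^n$, $p_i$ being the preferred spot of car $i$. In the MVP parking process, cars $1,\dots,n$ enter (in this order) a one-way street with spots $1,\dots,n$. Car $i$ parks in spot $p_i$; if $p_i$ is already occupied by an earlier car $j$, then car $j$ is bumped out and drives on, parking in the first unoccupied spot $k>p_i$ (if any); a bumped car does not bump other cars. $p$ is an MVP parking function if all cars manage to park; the set $\mathrm{MVP}_n$ of these coincides with the set of classical parking functions (those $p$ whose non-decreasing rearrangement $a_1\le\dots\le a_n$ satisfies $a_i\le i$ for all $i$). The MVP outcome $\mathcal{O}_{\mathrm{MVP}_n}(p)$ is the permutation $\pi=\pi_1\cdots\pi_n$ where $\pi_i$ is the label of the car occupying spot $i$ at the end; $\mathcal{O}^{-1}_{\mathrm{MVP}_n}(\pi)$ is the set of $p\in\mathrm{MVP}_n$ with outcome $\pi$. For $\pi\in S_n$, $\mathrm{Inv}(\pi)=\{(j,i): j<i,\ \pi_j>\pi_i\}$, and $\mathrm{Sub}(\pi)$ is the set of subsets $S\subseteq\mathrm{Inv}(\pi)$ such that for each $i\in[n]$ there is at most one $j$ with $(j,i)\in S$ (called $1$-subgraphs of the inversion graph of $\pi$). (For $p$ in the fibre of $\pi$, $\Psi_{\mathrm{PF}\to\mathrm{Sub}}(p)$ indeed lies in $\mathrm{Sub}(\pi)$.) *)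

theory Defs
  imports "HOL-Combinatorics.Permutations" "HOL-Library.FuncSet"
begin

text \<open>A preference is an extensional function on \<open>{1..n}\<close>, so that equality of preferences
  is equality of tuples.\<close>

definition parking_preferences :: "nat \<Rightarrow> (nat \<Rightarrow> nat) set" where
  "parking_preferences n = {1..n} \<rightarrow>\<^sub>E {1..n}"

text \<open>A street configuration is a partial map from spots to the cars occupying them. In
  \<open>mvp_step\<close> car \<open>c\<close> enters the street; a bumped car that finds no free spot further on
  leaves the street and no longer occurs in the configuration.\<close>

definition mvp_step :: "nat \<Rightarrow> (nat \<Rightarrow> nat) \<Rightarrow> nat \<Rightarrow> (nat \<rightharpoonup> nat) \<Rightarrow> (nat \<rightharpoonup> nat)" where
  "mvp_step n p c s =
     (case s (p c) of
        None \<Rightarrow> s(p c \<mapsto> c)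
      | Some b \<Rightarrow>
          (let free = {k. p c < k \<and> k \<le> n \<and> s k = None} in
             if free = {} then s(p c \<mapsto> c)
             else s(p c \<mapsto> c, Min free \<mapsto> b)))"

primrec mvp_street :: "nat \<Rightarrow> (nat \<Rightarrow> nat) \<Rightarrow> nat \<Rightarrow> (nat \<rightharpoonup> nat)" where
  "mvp_street n p 0 = Map.empty"
| "mvp_street n p (Suc m) = mvp_step n p (Suc m) (mvp_street n p m)"

definition MVP :: "nat \<Rightarrow> (nat \<Rightarrow> nat) set" where
  "MVP n = {p \<in> parking_preferences n. \<forall>c\<in>{1..n}. c \<in> ran (mvp_street n p n)}"

text \<open>The outcome is extended by the identity outside \<open>{1..n}\<close>, matching the convention of
  \<open>permutes\<close>.\<close>

definition mvp_outcome :: "nat \<Rightarrow> (nat \<Rightarrow> nat) \<Rightarrow> (nat \<Rightarrow> nat)" where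
  "mvp_outcome n p = (\<lambda>i. if i \<in> {1..n} then the (mvp_street n p n i) else i)"

definition mvp_fibre :: "nat \<Rightarrow> (nat \<Rightarrow> nat) \<Rightarrow> (nat \<Rightarrow> nat) set" where
  "mvp_fibre n \<pi> = {p \<in> MVP n. mvp_outcome n p = \<pi>}"

definition Inversions :: "nat \<Rightarrow> (nat \<Rightarrow> nat) \<Rightarrow> (nat \<times> nat) set" where
  "Inversions n \<pi> = {(j, i). j \<in> {1..n} \<and> i \<in> {1..n} \<and> j < i \<and> \<pi> j > \<pi> i}"

definition Sub :: "nat \<Rightarrow> (nat \<Rightarrow> nat) \<Rightarrow> (nat \<times> nat) set set" where
  "Sub n \<pi> = {S. S \<subseteq> Inversions n \<pi> \<and> (\<forall>i\<in>{1..n}. \<exists>\<^sub>\<le>\<^sub>1 j. (j, i) \<in> S)}"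

definition Psi_PF_Sub :: "nat \<Rightarrow> (nat \<Rightarrow> nat) \<Rightarrow> (nat \<Rightarrow> nat) \<Rightarrow> (nat \<times> nat) set" where
  "Psi_PF_Sub n \<pi> p = {(j, i) \<in> Inversions n \<pi>. p (\<pi> i) = j}"

text \<open>The value at car \<open>c\<close> is prescribed through the spot \<open>i\<close> with \<open>\<pi> i = c\<close>.\<close>

definition Psi_Sub_PF :: "nat \<Rightarrow> (nat \<Rightarrow> nat) \<Rightarrow> (nat \<times> nat) set \<Rightarrow> (nat \<Rightarrow> nat)" where
  "Psi_Sub_PF n \<pi> S =
     (\<lambda>c\<in>{1..n}. let i = inv \<pi> c in
        if \<exists>j. (j, i) \<in> S then THE j. (j, i) \<in> S else i)"

end

theory Submission
  imports Defs
begin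

text \<open>In any reachable street configuration a car sits at or beyond its preferred spot, all spots
  in between are occupied, and if it does not sit at its preferred spot then that spot is held by
  a later car (the one that bumped it, or a successor of that car). Hence \<open>p (\<pi> i)\<close> is either
  \<open>i\<close> or the first component of an inversion \<open>(p (\<pi> i), i)\<close>, which makes \<open>Psi_Sub_PF\<close> a left inverse
  of \<open>Psi_PF_Sub\<close>. Conversely, if \<open>p (\<pi> i) \<le> i\<close> for all \<open>i\<close>, no car is ever lost: a lost car would
  yield a free (or zeroth) spot \<open>a\<close> with more than \<open>n - a\<close> cars preferring spots beyond \<open>a\<close>.\<close>

section \<open>An invariant of the MVP process\<close>

definition coherent_street :: "nat \<Rightarrow> (nat \<Rightarrow> nat) \<Rightarrow> nat \<Rightarrow> (nat \<rightharpoonup> nat) \<Rightarrow> bool" where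
  "coherent_street n p m s \<longleftrightarrow>
     (\<forall>k d. s k = Some d \<longrightarrow> k \<in> {1..n} \<and> d \<in> {1..m} \<and> p d \<le> k \<and>
        (\<forall>j. p d \<le> j \<longrightarrow> j \<le> k \<longrightarrow> s j \<noteq> None) \<and>
        (p d < k \<longrightarrow> (\<exists>e>d. s (p d) = Some e))) \<and>
     (\<forall>k l d. s k = Some d \<longrightarrow> s l = Some d \<longrightarrow> k = l)"

lemma coherent_streetD:
  assumes "coherent_street n p m s" and "s k = Some d"
  shows "k \<in> {1..n}" "d \<in> {1..m}" "p d \<le> k"
    "p d \<le> j \<Longrightarrow> j \<le> k \<Longrightarrow> s j \<noteq> None"
    "p d < k \<Longrightarrow> \<exists>e>d. s (p d) = Some e"
    "s l = Some d \<Longrightarrow> k = l"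
  using assms unfolding coherent_street_def by blast+

lemma parking_preferences_mem:
  assumes "p \<in> parking_preferences n" and "c \<in> {1..n}"
  shows "p c \<in> {1..n}"
  using assms unfolding parking_preferences_def by (rule PiE_mem)

text \<open>The case \<open>park\<close> joins two situations with the same update: the preferred
  spot is empty, or it is occupied and no free spot lies beyond it. In the second one the previous
  occupant is overwritten, that is, lost.\<close>

lemma mvp_step_cases:
  obtains (park) "s (p c) = None \<or> {k. p c < k \<and> k \<le> n \<and> s k = None} = {}"
      "mvp_step n p c s = s(p c \<mapsto> c)"
  | (bump) b f where "s (p c) = Some b" "p c < f" "f \<le> n" "s f = None"
      "\<And>j. p c < j \<Longrightarrow> j < f \<Longrightarrow> s j \<noteq> None"
      "mvp_step n p c s = s(p c \<mapsto> c, f \<mapsto> b)"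
proof -
  define free where "free = {k. p c < k \<and> k \<le> n \<and> s k = None}"
  have fin: "finite free"
    unfolding free_def by simp
  show thesis
  proof (cases "s (p c) = None \<or> free = {}")
    case True
    then show thesis
      by (intro park) (auto simp: mvp_step_def free_def Let_def split: option.splits)
  next
    case False
    then obtain b where b: "s (p c) = Some b" and ne: "free \<noteq> {}"
      by auto
    have "Min free \<in> free"
      using fin ne by (rule Min_in)
    then have f: "p c < Min free" "Min free \<le> n" "s (Min free) = None"
      by (simp_all only: free_def mem_Collect_eq)
    have "s j \<noteq> None" if "p c < j" "j < Min free" for j
    proof
      assume "s j = None"
      then have "j \<in> free"
        using that f(2) by (simp add: free_def)
      with fin have "Min free \<le> j" by (rule Min_le)
      with that(2) show False by simp
    qed
    moreover have "mvp_step n p c s = s(p c \<mapsto> c, Min free \<mapsto> b)"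
      using b ne by (simp add: mvp_step_def free_def[symmetric])
    ultimately show thesis
      by (rule bump[OF b f])
  qed
qed

text \<open>The update never empties a spot. It may overwrite an occupant, but \<open>Suc m\<close>
  exceeds every label on the street, so a witness \<open>e > d\<close> at a preferred spot is at
  worst replaced by a larger one.\<close>

lemma coherent_street_park:
  assumes "coherent_street n p m s" and "p (Suc m) \<in> {1..n}"
  shows "coherent_street n p (Suc m) (s(p (Suc m) \<mapsto> Suc m))"
proof -
  note D = coherent_streetD[OF assms(1)]
  let ?s = "s(p (Suc m) \<mapsto> Suc m)"
  have "k \<in> {1..n} \<and> d \<in> {1..Suc m} \<and> p d \<le> k \<and>
        (\<forall>j. p d \<le> j \<longrightarrow> j \<le> k \<longrightarrow> ?s j \<noteq> None) \<and>
        (p d < k \<longrightarrow> (\<exists>e>d. ?s (p d) = Some e))" if k: "?s k = Some d" for k d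
  proof (cases "k = p (Suc m)")
    case True
    then show ?thesis using k assms(2) by auto
  next
    case False
    then have s: "s k = Some d" using k by simp
    show ?thesis
      using D(1-5)[OF s] by auto
  qed
  moreover have "k = l" if "?s k = Some d" "?s l = Some d" for k l d
  proof -
    have "s i \<noteq> Some (Suc m)" for i
      using D(2)[of i "Suc m"] by auto
    then show ?thesis
      using that D(6) by (metis fun_upd_apply option.inject)
  qed
  ultimately show ?thesis
    unfolding coherent_street_def by blast
qed

text \<open>Only the new position \<open>f\<close> of \<open>b\<close> needs an argument: the spots
  from \<open>p b\<close> to the old spot of \<open>b\<close> are occupied by coherence of
  \<open>s\<close>, those from there up to \<open>f\<close> by \<open>occ\<close>.\<close>

lemma coherent_street_bump:
  assumes coh: "coherent_street n p m s" and c: "p (Suc m) \<in> {1..n}"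
    and b: "s (p (Suc m)) = Some b" and f: "p (Suc m) < f" "f \<le> n" "s f = None"
    and occ: "\<And>j. p (Suc m) < j \<Longrightarrow> j < f \<Longrightarrow> s j \<noteq> None"
  shows "coherent_street n p (Suc m) (s(p (Suc m) \<mapsto> Suc m, f \<mapsto> b))"
proof -
  note D = coherent_streetD[OF coh]
  let ?s = "s(p (Suc m) \<mapsto> Suc m, f \<mapsto> b)"
  have "k \<in> {1..n} \<and> d \<in> {1..Suc m} \<and> p d \<le> k \<and>
        (\<forall>j. p d \<le> j \<longrightarrow> j \<le> k \<longrightarrow> ?s j \<noteq> None) \<and>
        (p d < k \<longrightarrow> (\<exists>e>d. ?s (p d) = Some e))" if k: "?s k = Some d" for k d
  proof -
    consider "k = f" | "k = p (Suc m)" "k \<noteq> f" | "k \<noteq> f" "k \<noteq> p (Suc m)" by blast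
    then show ?thesis
    proof cases
      case 1
      then have [simp]: "d = b" using k by simp
      have "s j \<noteq> None" if "p b \<le> j" "j < f" for j
        using that D(4)[OF b, of j] occ[of j] by linarith
      moreover have "\<exists>e>b. ?s (p b) = Some e"
      \<comment> \<open>If \<open>b\<close> stood on its preferred spot, the later car there is now
        \<open>Suc m\<close>; otherwise it was already there in \<open>s\<close>.\<close>
      proof (cases "p b = p (Suc m)")
        case True
        then show ?thesis using D(2)[OF b] f by auto
      next
        case False
        then have "p b < p (Suc m)" using D(3)[OF b] by simp
        then show ?thesis using D(5)[OF b] f by auto
      qed
      ultimately show ?thesis
        using 1 D(1-3)[OF b] f by (auto simp: nat_less_le)
    next
      case 2
      then show ?thesis using k c by auto
    next
      case 3
      then have s: "s k = Some d" using k by simp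
      show ?thesis
        using D(1-5)[OF s] f by auto
    qed
  qed
  moreover have "k = l" if "?s k = Some d" "?s l = Some d" for k l d
  proof -
    have "s i \<noteq> Some (Suc m)" for i
      using D(2)[of i "Suc m"] by auto
    \<comment> \<open>The only spot that held \<open>b\<close> is overwritten by
      \<open>Suc m\<close>, so moving \<open>b\<close> to \<open>f\<close> creates no second
      copy.\<close>
    moreover have "i = p (Suc m)" if "s i = Some b" for i
      using D(6)[OF that b] .
    moreover have "b \<noteq> Suc m"
      using D(2)[OF b] by simp
    ultimately show ?thesis
      using that D(6) by (metis fun_upd_apply option.inject)
  qed
  ultimately show ?thesis
    unfolding coherent_street_def by blast
qed

lemma coherent_mvp_street:
  assumes "p \<in> parking_preferences n"
  shows "m \<le> n \<Longrightarrow> coherent_street n p m (mvp_street n p m)"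
proof (induction m)
  case 0
  show ?case by (simp add: coherent_street_def)
next
  case (Suc m)
  have c: "p (Suc m) \<in> {1..n}"
    using parking_preferences_mem[OF assms] Suc.prems by simp
  have coh: "coherent_street n p m (mvp_street n p m)"
    using Suc by simp
  show ?case
  proof (cases rule: mvp_step_cases[of "mvp_street n p m" p "Suc m" n])
    case park
    then show ?thesis using coherent_street_park[OF coh c] by (simp only: mvp_street.simps)
  next
    case (bump b f)
    then show ?thesis using coherent_street_bump[OF coh c bump(1-5)] by (simp only: mvp_street.simps)
  qed
qed

section \<open>The final street of a parking function\<close>

text \<open>All \<open>n\<close> cars occur as values of the street, so at least \<open>n\<close>
  spots are occupied, while coherence confines them to \<open>{1..n}\<close>.\<close>

lemma dom_mvp_street_MVP:
  assumes "p \<in> MVP n"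
  shows "dom (mvp_street n p n) = {1..n}"
proof (rule card_subset_eq)
  let ?s = "mvp_street n p n"
  have "coherent_street n p n ?s"
    using assms by (simp add: coherent_mvp_street MVP_def)
  from coherent_streetD(1)[OF this] show sub: "dom ?s \<subseteq> {1..n}"
    by blast
  have "Some ` {1..n} \<subseteq> ?s ` dom ?s"
  proof
    fix x assume "x \<in> Some ` {1..n}"
    then obtain c where "c \<in> {1..n}" "x = Some c" by blast
    with assms have "c \<in> ran ?s" by (simp add: MVP_def)
    then obtain k where "?s k = Some c" unfolding ran_def by blast
    with \<open>x = Some c\<close>[symmetric] show "x \<in> ?s ` dom ?s" by force
  qed
  from card_mono[OF _ this] have "card (Some ` {1..n}) \<le> card (dom ?s)"
    using sub finite_subset card_image_le by (meson finite_atLeastAtMost finite_imageI order_trans)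
  then have "n \<le> card (dom ?s)"
    by (simp add: card_image)
  then show "card (dom ?s) = card {1..n}"
    using card_mono[OF _ sub] by simp
qed simp

lemma mvp_fibre_street:
  assumes "p \<in> mvp_fibre n \<pi>" and "i \<in> {1..n}"
  shows "mvp_street n p n i = Some (\<pi> i)"
proof -
  have "i \<in> dom (mvp_street n p n)"
    using assms dom_mvp_street_MVP by (simp add: mvp_fibre_def)
  then show ?thesis
    using assms by (auto simp: mvp_fibre_def mvp_outcome_def)
qed

text \<open>If \<open>p (\<pi> i) < i\<close>, coherence puts a car later than
  \<open>\<pi> i\<close> on spot \<open>p (\<pi> i)\<close>. In the final street that car is
  \<open>\<pi> (p (\<pi> i))\<close>, and this is the inversion.\<close>

lemma mvp_fibre_preference:
  assumes "p \<in> mvp_fibre n \<pi>" and "i \<in> {1..n}" and "\<pi> permutes {1..n}"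
  shows "p (\<pi> i) = i \<or> (p (\<pi> i), i) \<in> Inversions n \<pi>"
proof -
  have p: "p \<in> parking_preferences n"
    using assms(1) by (simp add: mvp_fibre_def MVP_def)
  note D = coherent_streetD[OF coherent_mvp_street[OF p order_refl] mvp_fibre_street[OF assms(1,2)]]
  have "\<pi> i \<in> {1..n}"
    using assms(2,3) by (simp only: permutes_in_image)
  then have r: "p (\<pi> i) \<in> {1..n}"
    by (rule parking_preferences_mem[OF p])
  show ?thesis
  proof (cases "p (\<pi> i) = i")
    case False
    then have "p (\<pi> i) < i" using D(3) by simp
    with D(5) show ?thesis
      using mvp_fibre_street[OF assms(1) r] r assms(2) by (auto simp: Inversions_def)
  qed simp
qed

section \<open>No car is lost under the domination condition\<close>

lemma free_spot_available:
  assumes coh: "coherent_street n p m s" and "m < n" and \<pi>: "\<pi> permutes {1..n}"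
    and le: "\<And>i. i \<in> {1..n} \<Longrightarrow> p (\<pi> i) \<le> i"
    and c: "p (Suc m) \<in> {1..n}" and full: "s (p (Suc m)) \<noteq> None"
  shows "{k. p (Suc m) < k \<and> k \<le> n \<and> s k = None} \<noteq> {}"
proof
  assume none: "{k. p (Suc m) < k \<and> k \<le> n \<and> s k = None} = {}"
  note D = coherent_streetD[OF coh]
  define A where "A = {a. a < p (Suc m) \<and> s a = None}"
  define a where "a = Max A"
  have fin: "finite A" unfolding A_def by simp
  \<comment> \<open>Spot 0 is a sentinel outside the street: it makes \<open>A\<close> nonempty, so
    the maximum \<open>a\<close> exists even if all real spots before \<open>p (Suc m)\<close> are
    occupied.\<close>
  have "s 0 = None"
    using D(1)[of 0] by (cases "s 0") auto
  then have "0 \<in> A"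
    using c by (simp add: A_def)
  with fin have "a \<in> A"
    unfolding a_def by (intro Max_in) auto
  then have a: "a < p (Suc m)" "s a = None"
    by (auto simp: A_def)
  \<comment> \<open>Spots strictly between \<open>a\<close> and \<open>p (Suc m)\<close> are
    occupied by maximality of \<open>a\<close>, the spot \<open>p (Suc m)\<close> by
    \<open>full\<close>, and later ones by \<open>none\<close>.\<close>
  have occ: "\<exists>d. s k = Some d" if "k \<in> {a<..n}" for k
  proof (rule ccontr)
    assume "\<nexists>d. s k = Some d"
    then have "s k = None" by simp
    moreover from this have "k < p (Suc m)"
      using that none full by (metis (mono_tags, lifting) empty_Collect_eq greaterThanAtMost_iff
          linorder_neqE_nat)
    ultimately have "k \<le> a"
      unfolding a_def using fin by (intro Max_ge) (auto simp: A_def)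
    then show False using that by simp
  qed
  define D' where "D' = (\<lambda>k. the (s k)) ` {a<..n}"
  have "inj_on (\<lambda>k. the (s k)) {a<..n}"
    using occ D(6) by (intro inj_onI) (metis option.sel)
  then have card: "card D' = n - a"
    unfolding D'_def by (simp add: card_image)
  \<comment> \<open>A car parked beyond \<open>a\<close> with preference at most \<open>a\<close>
    would force spot \<open>a\<close> to be occupied.\<close>
  have D': "d \<in> {1..m} \<and> a < p d" if "d \<in> D'" for d
  proof -
    from that obtain k where k: "k \<in> {a<..n}" "d = the (s k)"
      unfolding D'_def by (elim imageE)
    with occ have s: "s k = Some d" by force
    show ?thesis
      using D(2)[OF s] D(4)[OF s, of a] a(2) k(1) by force
  qed
  \<comment> \<open>By \<open>le\<close>, a car \<open>\<pi> i\<close> preferring a spot beyond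
    \<open>a\<close> has \<open>i > a\<close>. This leaves room for \<open>n - a\<close> cars, but
    \<open>D'\<close> and \<open>Suc m\<close> make one more.\<close>
  have "insert (Suc m) D' \<subseteq> \<pi> ` {a<..n}"
  proof
    fix d assume "d \<in> insert (Suc m) D'"
    then have d: "d \<in> {1..n}" "a < p d"
      using D' a(1) \<open>m < n\<close> by force+
    from d(1) obtain i where i: "i \<in> {1..n}" "d = \<pi> i"
      using permutes_image[OF \<pi>] by blast
    with le d(2) show "d \<in> \<pi> ` {a<..n}"
      by force
  qed
  then have "card (insert (Suc m) D') \<le> card (\<pi> ` {a<..n})"
    by (intro card_mono) auto
  also have "\<dots> \<le> n - a"
    using card_image_le[of "{a<..n}" \<pi>] by simp
  finally have "card (insert (Suc m) D') \<le> n - a" .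
  moreover have "Suc m \<notin> D'" "finite D'"
    using D'[of "Suc m"] by (auto simp: D'_def)
  ultimately show False
    using card by simp
qed

lemma all_cars_parked:
  assumes p: "p \<in> parking_preferences n" and \<pi>: "\<pi> permutes {1..n}"
    and le: "\<And>i. i \<in> {1..n} \<Longrightarrow> p (\<pi> i) \<le> i"
  shows "m \<le> n \<Longrightarrow> {1..m} \<subseteq> ran (mvp_street n p m)"
proof (induction m)
  case 0
  show ?case by simp
next
  case (Suc m)
  let ?s = "mvp_street n p m"
  have c: "p (Suc m) \<in> {1..n}"
    using parking_preferences_mem[OF p] Suc.prems by simp
  have coh: "coherent_street n p m ?s"
    using coherent_mvp_street[OF p] Suc.prems by simp
  have IH: "{1..m} \<subseteq> ran ?s"
    using Suc by simp
  show ?case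
  proof (cases rule: mvp_step_cases[of ?s p "Suc m" n])
    case park
    then have "?s (p (Suc m)) = None"
      using free_spot_available[OF coh _ \<pi> le c] Suc.prems Suc_le_lessD by blast
    then have "ran (mvp_street n p (Suc m)) = insert (Suc m) (ran ?s)"
      using park(2) by (simp add: ran_map_upd)
    then show ?thesis using IH by (auto simp: le_Suc_eq)
  next
    case (bump b f)
    have "ran ?s \<subseteq> ran (?s(p (Suc m) \<mapsto> Suc m, f \<mapsto> b))"
    proof
      fix d assume "d \<in> ran ?s"
      then obtain k where k: "?s k = Some d" by (auto simp: ran_def)
      \<comment> \<open>The car at \<open>p (Suc m)\<close> is \<open>b\<close>, found again at
        \<open>f\<close>; all other cars stay, since \<open>f\<close> was empty.\<close>
      have "(?s(p (Suc m) \<mapsto> Suc m, f \<mapsto> b)) (if k = p (Suc m) then f else k) = Some d"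
        using k bump by auto
      then show "d \<in> ran (?s(p (Suc m) \<mapsto> Suc m, f \<mapsto> b))" by (rule ranI)
    qed
    moreover have "Suc m \<in> ran (?s(p (Suc m) \<mapsto> Suc m, f \<mapsto> b))"
      using bump(2) by (intro ranI[of _ "p (Suc m)"]) auto
    ultimately have "insert (Suc m) {1..m} \<subseteq> ran (mvp_street n p (Suc m))"
      using IH unfolding mvp_street.simps bump(6) by blast
    then show ?thesis
      by (simp only: atLeastAtMostSuc_conv le_add1 plus_1_eq_Suc One_nat_def Suc_le_mono le0)
  qed
qed

text \<open>The domination says that \<open>p\<close> is a classical parking function, with
  \<open>\<pi>\<close> as the witnessing rearrangement; \<open>\<pi>\<close> may differ from the
  outcome of \<open>p\<close>.\<close>

lemma MVP_if_dominated:
  assumes "p \<in> parking_preferences n" and "\<pi> permutes {1..n}"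
    and "\<And>i. i \<in> {1..n} \<Longrightarrow> p (\<pi> i) \<le> i"
  shows "p \<in> MVP n"
  using all_cars_parked[OF assms order_refl] assms(1) by (auto simp: MVP_def)

section \<open>The maps between preferences and 1-subgraphs\<close>

lemma Psi_Sub_PF_apply:
  assumes "\<pi> permutes {1..n}" and "i \<in> {1..n}"
  shows "Psi_Sub_PF n \<pi> S (\<pi> i) = (if \<exists>j. (j, i) \<in> S then THE j. (j, i) \<in> S else i)"
proof -
  have "\<pi> i \<in> {1..n}"
    using assms by (simp only: permutes_in_image)
  then show ?thesis
    using permutes_inverses(2)[OF assms(1)] by (simp add: Psi_Sub_PF_def)
qed

lemma Psi_Sub_PF_edge:
  assumes "\<pi> permutes {1..n}" and "S \<in> Sub n \<pi>" and "(j, i) \<in> S"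
  shows "Psi_Sub_PF n \<pi> S (\<pi> i) = j"
proof -
  have i: "i \<in> {1..n}" and u: "\<exists>\<^sub>\<le>\<^sub>1 j. (j, i) \<in> S"
    using assms(2,3) by (auto simp: Sub_def Inversions_def)
  have "(THE j. (j, i) \<in> S) = j"
    using u assms(3) by (rule the1_equality')
  then show ?thesis
    using Psi_Sub_PF_apply[OF assms(1) i, of S] assms(3) by auto
qed

lemma Psi_Sub_PF_no_edge:
  assumes "\<pi> permutes {1..n}" and "i \<in> {1..n}" and "\<nexists>j. (j, i) \<in> S"
  shows "Psi_Sub_PF n \<pi> S (\<pi> i) = i"
  using Psi_Sub_PF_apply[OF assms(1,2), of S] assms(3) by simp

text \<open>An edge into \<open>i\<close> gives a value below \<open>i\<close>, its absence gives
  \<open>i\<close> itself, so the preference determines \<open>S\<close>. This yields injectivity of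
  \<open>Psi_Sub_PF\<close>.\<close>

lemma mem_Sub_iff_Psi_Sub_PF:
  assumes "\<pi> permutes {1..n}" and "S \<in> Sub n \<pi>"
  shows "(j, i) \<in> S \<longleftrightarrow> i \<in> {1..n} \<and> Psi_Sub_PF n \<pi> S (\<pi> i) = j \<and> j < i"
proof
  assume "(j, i) \<in> S"
  then show "i \<in> {1..n} \<and> Psi_Sub_PF n \<pi> S (\<pi> i) = j \<and> j < i"
    using Psi_Sub_PF_edge[OF assms] assms(2) by (auto simp: Sub_def Inversions_def)
next
  assume "i \<in> {1..n} \<and> Psi_Sub_PF n \<pi> S (\<pi> i) = j \<and> j < i"
  then show "(j, i) \<in> S"
    using Psi_Sub_PF_edge[OF assms] Psi_Sub_PF_no_edge[OF assms(1), of i S] by fastforce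
qed

lemma Psi_Sub_PF_in_MVP:
  assumes \<pi>: "\<pi> permutes {1..n}" and S: "S \<in> Sub n \<pi>"
  shows "Psi_Sub_PF n \<pi> S \<in> MVP n"
proof (rule MVP_if_dominated[OF _ \<pi>])
  have bounds: "Psi_Sub_PF n \<pi> S (\<pi> i) \<in> {1..i}" if "i \<in> {1..n}" for i
  proof (cases "\<exists>j. (j, i) \<in> S")
    case True
    then obtain j where "(j, i) \<in> S" by blast
    then show ?thesis
      using Psi_Sub_PF_edge[OF \<pi> S] S by (auto simp: Sub_def Inversions_def)
  next
    case False
    then show ?thesis
      using Psi_Sub_PF_no_edge[OF \<pi> that] that by simp
  qed
  then show "Psi_Sub_PF n \<pi> S (\<pi> i) \<le> i" if "i \<in> {1..n}" for i
    using that by simp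
  show "Psi_Sub_PF n \<pi> S \<in> parking_preferences n"
    unfolding parking_preferences_def
  proof (rule PiE_I)
    fix c assume "c \<in> {1..n}"
    then obtain i where "i \<in> {1..n}" "c = \<pi> i"
      using permutes_image[OF \<pi>] by blast
    then show "Psi_Sub_PF n \<pi> S c \<in> {1..n}"
      using bounds[of i] by simp
  next
    fix c assume "c \<notin> {1..n}"
    then show "Psi_Sub_PF n \<pi> S c = undefined"
      unfolding Psi_Sub_PF_def by (simp only: restrict_apply if_False)
  qed
qed

lemma Psi_PF_Sub_in_Sub: "Psi_PF_Sub n \<pi> p \<in> Sub n \<pi>"
  by (auto simp: Psi_PF_Sub_def Sub_def Uniq_def)

lemma Psi_Sub_PF_Psi_PF_Sub:
  assumes \<pi>: "\<pi> permutes {1..n}" and p: "p \<in> mvp_fibre n \<pi>"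
  shows "Psi_Sub_PF n \<pi> (Psi_PF_Sub n \<pi> p) = p"
proof (rule PiE_ext)
  show "p \<in> {1..n} \<rightarrow>\<^sub>E {1..n}"
    using p by (simp add: mvp_fibre_def MVP_def parking_preferences_def)
  show "Psi_Sub_PF n \<pi> (Psi_PF_Sub n \<pi> p) \<in> {1..n} \<rightarrow>\<^sub>E {1..n}"
    using Psi_Sub_PF_in_MVP[OF \<pi> Psi_PF_Sub_in_Sub] by (simp add: MVP_def parking_preferences_def)
  fix c assume "c \<in> {1..n}"
  then obtain i where i: "i \<in> {1..n}" "c = \<pi> i"
    using permutes_image[OF \<pi>] by blast
  show "Psi_Sub_PF n \<pi> (Psi_PF_Sub n \<pi> p) c = p c"
  proof (cases "(p (\<pi> i), i) \<in> Inversions n \<pi>")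
    case True
    then have "(p (\<pi> i), i) \<in> Psi_PF_Sub n \<pi> p"
      by (simp add: Psi_PF_Sub_def)
    then show ?thesis
      using Psi_Sub_PF_edge[OF \<pi> Psi_PF_Sub_in_Sub] i by simp
  next
    case False
    \<comment> \<open>Any edge into \<open>i\<close> would start at \<open>p (\<pi> i)\<close>, so
      there is none, and the dichotomy for the fibre leaves \<open>p (\<pi> i) = i\<close>, the
      default value of \<open>Psi_Sub_PF\<close>.\<close>
    then have "\<nexists>j. (j, i) \<in> Psi_PF_Sub n \<pi> p" and "p (\<pi> i) = i"
      using mvp_fibre_preference[OF p i(1) \<pi>] by (auto simp: Psi_PF_Sub_def)
    then show ?thesis
      using Psi_Sub_PF_no_edge[OF \<pi> i(1)] i by simp
  qed
qed

theorem theorem2p5: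
  fixes n :: nat and \<pi> :: "nat \<Rightarrow> nat"
  assumes "n \<ge> 1" and "\<pi> permutes {1..n}"
  shows "Psi_PF_Sub n \<pi> \<in> mvp_fibre n \<pi> \<rightarrow> Sub n \<pi>
    \<and> Psi_Sub_PF n \<pi> \<in> Sub n \<pi> \<rightarrow> MVP n
    \<and> inj_on (Psi_PF_Sub n \<pi>) (mvp_fibre n \<pi>)
    \<and> inj_on (Psi_Sub_PF n \<pi>) (Sub n \<pi>)
    \<and> (\<forall>p \<in> mvp_fibre n \<pi>. Psi_Sub_PF n \<pi> (Psi_PF_Sub n \<pi> p) = p)"
proof (intro conjI)
  note \<pi> = assms(2)
  show "Psi_PF_Sub n \<pi> \<in> mvp_fibre n \<pi> \<rightarrow> Sub n \<pi>"
    by (simp add: Psi_PF_Sub_in_Sub)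
  show "Psi_Sub_PF n \<pi> \<in> Sub n \<pi> \<rightarrow> MVP n"
    using Psi_Sub_PF_in_MVP[OF \<pi>] by blast
  show left_inverse: "\<forall>p \<in> mvp_fibre n \<pi>. Psi_Sub_PF n \<pi> (Psi_PF_Sub n \<pi> p) = p"
    using Psi_Sub_PF_Psi_PF_Sub[OF \<pi>] by blast
  then show "inj_on (Psi_PF_Sub n \<pi>) (mvp_fibre n \<pi>)"
    by (intro inj_on_inverseI[of _ "Psi_Sub_PF n \<pi>"]) blast
  show "inj_on (Psi_Sub_PF n \<pi>) (Sub n \<pi>)"
  proof (rule inj_onI)
    fix S T
    assume "S \<in> Sub n \<pi>" "T \<in> Sub n \<pi>" and eq: "Psi_Sub_PF n \<pi> S = Psi_Sub_PF n \<pi> T"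
    then have "(j, i) \<in> S \<longleftrightarrow> (j, i) \<in> T" for j i
      using mem_Sub_iff_Psi_Sub_PF[OF \<pi>] by simp
    then show "S = T"
      by auto
  qed
qed

end
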